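(* Let $n\ge3$ be an integer and $m\ge4$ an even integer with $(n,m)\ne(3,4)$, and consider the problem of maximizing $f(\mathbf u)=\sum_{i=1}^n u_i^m$ over $\mathbf u\in\mathbb R^n$ subject to $\mathbf u^{\mathrm T}\mathbf u=1$ and $\mathbf u^{\mathrm T}\mathbf 1_n=0$. Let $1\le k\le\lfloor n/2\rfloor$ and consider the stationary points $\mathbf u=\mathbf P[a\mathbf 1_k^{\mathrm T},\,b\mathbf 1_{n-k}^{\mathrm T}]^{\mathrm T}$, where $\mathbf P$ is an $n\times n$ permutation matrix, $a=\sqrt{\frac{n-k}{kn}}$ and $b=-\sqrt{\frac{k}{(n-k)n}}$. Then: (i) when $k=1$, these points are local maximum points of the problem; (ii) when $2\le k\le\lfloor n/2\rfloor$, put $$l(m,n,k)=(m-1)nk^{m-2}-(n-k)^{m-1}-k^{m-1}.$$ If $l(m,n,k)>0$, the corresponding points are local minimum points of the problem; if $l(m,n,k)<0$, they are saddle points of the problem.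
   Context: $\mathbf 1_k$ denotes the all-ones column vector of length $k$. A stationary point of the problem is a real $\mathbf u$ satisfying both constraints for which there exist real Lagrange multipliers $\alpha,\beta$ with $u_i^{m-1}-\alpha u_i-\beta=0$ for all $i$. Local maximum (minimum) points are understood relative to the feasible set $\{\mathbf u:\mathbf u^{\mathrm T}\mathbf u=1,\ \mathbf u^{\mathrm T}\mathbf 1_n=0\}$; a saddle point is a stationary point that is neither a local maximum nor a local minimum of $f$ on the feasible set. *)

theory Defs
  imports "HOL-Analysis.Analysis"
begin

definition objective :: "nat \<Rightarrow> real ^ 'n \<Rightarrow> real" where
  "objective m u = (\<Sum>i\<in>UNIV. (u $ i) ^ m)"

text \<open>Here \<open>1 :: real ^ 'n\<close> is the all-ones vector.\<close>

definition feasible_set :: "(real ^ 'n) set" where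
  "feasible_set = {u. u \<bullet> u = 1 \<and> u \<bullet> 1 = 0}"

definition stationary_point :: "nat \<Rightarrow> real ^ 'n \<Rightarrow> bool" where
  "stationary_point m u \<longleftrightarrow>
     u \<in> feasible_set \<and> (\<exists>\<alpha> \<beta>. \<forall>i. (u $ i) ^ (m - 1) - \<alpha> * u $ i - \<beta> = 0)"

definition local_max_on :: "('a::metric_space \<Rightarrow> real) \<Rightarrow> 'a set \<Rightarrow> 'a \<Rightarrow> bool" where
  "local_max_on f S u \<longleftrightarrow> u \<in> S \<and> (\<exists>e>0. \<forall>v\<in>S. dist v u < e \<longrightarrow> f v \<le> f u)"

definition local_min_on :: "('a::metric_space \<Rightarrow> real) \<Rightarrow> 'a set \<Rightarrow> 'a \<Rightarrow> bool" where
  "local_min_on f S u \<longleftrightarrow> u \<in> S \<and> (\<exists>e>0. \<forall>v\<in>S. dist v u < e \<longrightarrow> f u \<le> f v)"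

definition saddle_point :: "nat \<Rightarrow> real ^ 'n \<Rightarrow> bool" where
  "saddle_point m u \<longleftrightarrow> stationary_point m u \<and>
     \<not> local_max_on (objective m) feasible_set u \<and>
     \<not> local_min_on (objective m) feasible_set u"

definition permutation_matrix :: "real ^ 'n ^ 'n \<Rightarrow> bool" where
  "permutation_matrix P \<longleftrightarrow>
     (\<exists>p. p permutes UNIV \<and> P = (\<chi> i j. if i = p j then 1 else 0))"

text \<open>
  The column vector whose first \<open>k\<close> entries are \<open>a\<close> and whose remaining entries are \<open>b\<close>.
  The index type \<open>'n\<close> carries no order, so \<open>pos\<close> numbers the coordinates by \<open>1, \<dots>, CARD('n)\<close>.
\<close>

definition two_block_vec :: "('n::finite \<Rightarrow> nat) \<Rightarrow> nat \<Rightarrow> real \<Rightarrow> real \<Rightarrow> real ^ 'n" where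
  "two_block_vec pos k a b = (\<chi> i. if pos i \<le> k then a else b)"

definition l :: "nat \<Rightarrow> nat \<Rightarrow> nat \<Rightarrow> real" where
  "l m n k = (real m - 1) * real n * real k ^ (m - 2)
               - (real n - real k) ^ (m - 1) - real k ^ (m - 1)"

end

theory Submission
  imports Defs
begin

text \<open>
  Put \<open>m = M + 2\<close> and let \<open>u\<close> be a stationary point with multipliers \<open>\<alpha>, \<beta>\<close>. For a feasible
  \<open>u + h\<close> the constraints say that the entries of \<open>h\<close> sum to \<open>0\<close> and that \<open>u \<bullet> h = - (h \<bullet> h) / 2\<close>.
  The linear Taylor term of the objective \<open>f\<close> is therefore itself quadratic in \<open>h\<close>, and on the
  feasible set \<open>f (u + h) - f u\<close> is the sum of \<open>q_i h_i^2\<close> over all \<open>i\<close> up to \<open>o(|h|^2)\<close>, where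
  \<open>q_i = (m / 2) ((m - 1) u_i^(m - 2) - \<alpha>)\<close> (\<open>stationary_second_order_model\<close>). This diagonal
  form, half the Hessian of the Lagrangian, decides everything.

  For a point whose entries are \<open>a\<close> on a set \<open>A\<close> of \<open>k\<close> coordinates and \<open>b\<close> elsewhere, the form has
  only two weights. Write \<open>b = - c\<close> and \<open>a = r c\<close> with \<open>r = (n - k) / k \<ge> 1\<close>. Then
  \<open>\<alpha> = c^M (r^(M + 1) + 1) / (r + 1)\<close>; the weight on \<open>A\<close> is always positive
  (\<open>two_value_weight_pos\<close>) and the weight off \<open>A\<close> is a positive multiple of \<open>l m n k\<close>
  (\<open>two_value_weight_eq_l\<close>). This leaves three cases.

  \<^item> If \<open>l m n k > 0\<close>, the form is positive definite, so the point is a local minimum.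

  \<^item> If \<open>l m n k < 0\<close> and \<open>k \<ge> 2\<close>, both \<open>A\<close> and its complement contain two coordinates. The
    difference of the two unit vectors is tangent to the feasible set and sees only the weight
    of that block, so the form takes both signs on tangent vectors: the point is a saddle.

  \<^item> If \<open>k = 1\<close>, then \<open>l m n k < 0\<close> by an elementary inequality (\<open>linear_less_power\<close>), which
    turns into an equality at \<open>(n, m) = (3, 4)\<close>. The only positive weight belongs to a coordinate in
    which a feasible perturbation moves by just \<open>O(|h|^2)\<close>, so the negative weights win and the
    point is a local maximum (\<open>local_max_on_single_positive_weight\<close>).
\<close>

section \<open>Second-order models on a constraint set\<close>

definition diag_form :: "('n::finite \<Rightarrow> real) \<Rightarrow> real ^ 'n \<Rightarrow> real" where
  "diag_form q h = (\<Sum>i\<in>UNIV. q i * (h $ i)\<^sup>2)"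

text \<open>
  The expansion is required only along \<open>S\<close>. It has no linear term, so it can hold at constrained
  critical points where the unconstrained gradient of \<open>f\<close> does not vanish.
\<close>

definition second_order_model ::
  "(real ^ 'n::finite \<Rightarrow> real) \<Rightarrow> (real ^ 'n) set \<Rightarrow> real ^ 'n \<Rightarrow> ('n \<Rightarrow> real) \<Rightarrow> bool" where
  "second_order_model f S u q \<longleftrightarrow>
     (\<forall>e>0. \<exists>d>0. \<forall>v\<in>S. dist v u < d \<longrightarrow>
        \<bar>f v - f u - diag_form q (v - u)\<bar> \<le> e * (norm (v - u))\<^sup>2)"

lemma norm_power2_vec: "(norm h)\<^sup>2 = (\<Sum>i\<in>UNIV. (h $ i)\<^sup>2)" for h :: "real ^ 'n::finite"
  unfolding power2_norm_eq_inner inner_vec_def by (simp add: power2_eq_square)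

lemma diag_form_uminus: "diag_form (\<lambda>i. - q i) h = - diag_form q h"
  by (simp add: diag_form_def sum_negf)

lemma diag_form_scaleR: "diag_form q (c *\<^sub>R h) = c\<^sup>2 * diag_form q h"
  by (simp add: diag_form_def sum_distrib_left power_mult_distrib mult_ac)

lemma diag_form_combination:
  "diag_form q (s *\<^sub>R x + t *\<^sub>R y) =
     s\<^sup>2 * diag_form q x + 2 * s * t * (\<Sum>i\<in>UNIV. q i * x $ i * y $ i) + t\<^sup>2 * diag_form q y"
  unfolding diag_form_def sum_distrib_left sum.distrib[symmetric]
  by (intro sum.cong refl) (simp add: power2_eq_square algebra_simps)

lemma second_order_model_uminus:
  assumes "second_order_model f S u q"
  shows "second_order_model (\<lambda>v. - f v) S u (\<lambda>i. - q i)"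
proof -
  have "\<bar>- f v - - f u - diag_form (\<lambda>i. - q i) (v - u)\<bar> = \<bar>f v - f u - diag_form q (v - u)\<bar>" for v
    by (simp add: diag_form_uminus)
  then show ?thesis
    using assms unfolding second_order_model_def by simp
qed

lemma local_min_on_iff_local_max_on_uminus:
  "local_min_on f S u \<longleftrightarrow> local_max_on (\<lambda>v. - f v) S u"
  by (simp add: local_min_on_def local_max_on_def)

text \<open>
  Negative definiteness is asked for only along \<open>S\<close>, because a form that is indefinite on the whole
  space can still be negative on all small displacements within \<open>S\<close>.
\<close>

lemma local_max_on_sufficient:
  assumes model: "second_order_model f S u q" and "u \<in> S" and "c > 0" and "r > 0"
    and neg: "\<And>v. v \<in> S \<Longrightarrow> dist v u < r \<Longrightarrow> diag_form q (v - u) \<le> - c * (norm (v - u))\<^sup>2"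
  shows "local_max_on f S u"
proof -
  obtain d where "d > 0" and
    d: "\<And>v. v \<in> S \<Longrightarrow> dist v u < d \<Longrightarrow>
          \<bar>f v - f u - diag_form q (v - u)\<bar> \<le> c * (norm (v - u))\<^sup>2"
    using model \<open>c > 0\<close> unfolding second_order_model_def by blast
  have "f v \<le> f u" if "v \<in> S" "dist v u < min d r" for v
    using d[of v] neg[of v] that by (simp add: abs_le_iff)
  then show ?thesis
    using \<open>u \<in> S\<close> \<open>d > 0\<close> \<open>r > 0\<close> unfolding local_max_on_def
    by (intro conjI exI[of _ "min d r"]) auto
qed

section \<open>Second-order necessary condition on the feasible set\<close>

text \<open>
  The feasible set is a sphere in a hyperplane, so the great circle from \<open>u\<close> in a tangent unit
  direction \<open>w\<close> stays in it. A point of the circle differs from \<open>u\<close> by \<open>h = s w - p u\<close> with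
  \<open>s^2 + p^2 = 2 p\<close>, so \<open>|h|^2 = 2 p\<close> and the form at \<open>h\<close> is \<open>2 p\<close> times its value at \<open>w\<close>, up to
  \<open>O(p^2)\<close> and a mixed term of order \<open>p^(3/2)\<close>. The sign assumption on the mixed term spares an
  estimate of it.
\<close>

lemma not_local_max_on_unit:
  fixes u w :: "real ^ 'n::finite"
  assumes model: "second_order_model f feasible_set u q" and u: "u \<in> feasible_set"
    and w: "w \<bullet> w = 1" "u \<bullet> w = 0" "w \<bullet> 1 = 0"
    and mixed: "(\<Sum>i\<in>UNIV. q i * w $ i * u $ i) \<le> 0"
    and pos: "diag_form q w > 0"
  shows "\<not> local_max_on f feasible_set u"
proof
  assume "local_max_on f feasible_set u"
  then obtain r where "r > 0" and
    r: "\<And>v. v \<in> feasible_set \<Longrightarrow> dist v u < r \<Longrightarrow> f v \<le> f u"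
    unfolding local_max_on_def by blast
  define Q where "Q = diag_form q w"
  define D where "D = diag_form q u - Q"
  have "Q > 0" using pos by (simp add: Q_def)
  then obtain d where "d > 0" and
    d: "\<And>v. v \<in> feasible_set \<Longrightarrow> dist v u < d \<Longrightarrow>
          \<bar>f v - f u - diag_form q (v - u)\<bar> \<le> Q / 4 * (norm (v - u))\<^sup>2"
    using model unfolding second_order_model_def by (metis divide_pos_pos zero_less_numeral)
  define g where "g = min r d"
  have "g > 0" using \<open>r > 0\<close> \<open>d > 0\<close> by (simp add: g_def)
  \<comment> \<open>\<open>g\<^sup>2 / 4\<close> keeps the new point within distance \<open>g\<close>, as \<open>2 p < g\<^sup>2\<close>; \<open>1/2\<close> makes
      \<open>2 p - p\<^sup>2\<close> nonnegative, so that \<open>s\<^sup>2\<close> has this value; the last bound makes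
      the \<open>O(p\<^sup>2)\<close> part cost at most a quarter of the leading part \<open>2 p Q\<close>, and the error of the
      model costs another quarter.\<close>
  define p where "p = min (1/2) (min (g\<^sup>2 / 4) (Q / (2 * (\<bar>D\<bar> + 1))))"
  have "0 < p" using \<open>g > 0\<close> \<open>Q > 0\<close> by (simp add: p_def)
  moreover have "p \<le> 1/2" "p \<le> g\<^sup>2 / 4" "p \<le> Q / (2 * (\<bar>D\<bar> + 1))"
    unfolding p_def by linarith+
  ultimately have p: "0 < p" "p \<le> 1/2" "p \<le> g\<^sup>2 / 4" "p \<le> Q / (2 * (\<bar>D\<bar> + 1))" .
  define s where "s = sqrt (2 * p - p\<^sup>2)"
  have "p\<^sup>2 \<le> 2 * p" using p mult_left_mono[of p 1 p] by (simp add: power2_eq_square)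
  then have s2: "s\<^sup>2 = 2 * p - p\<^sup>2" and "s \<ge> 0" by (simp_all add: s_def)
  define v where "v = (1 - p) *\<^sub>R u + s *\<^sub>R w"
  have uu: "u \<bullet> u = 1" "u \<bullet> 1 = 0" using u by (auto simp: feasible_set_def)
  have "v \<bullet> v = (1 - p)\<^sup>2 + s\<^sup>2"
    using uu w by (simp add: v_def inner_add_left inner_add_right inner_commute[of w u] power2_eq_square)
  also have "\<dots> = 1" unfolding s2 by (simp add: power2_eq_square algebra_simps)
  finally have v: "v \<in> feasible_set"
    using uu w by (simp add: feasible_set_def) (simp add: v_def inner_add_left)
  have h: "v - u = s *\<^sub>R w + (- p) *\<^sub>R u" by (simp add: v_def algebra_simps)
  have "(norm (v - u))\<^sup>2 = s\<^sup>2 + p\<^sup>2"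
    using uu w unfolding h power2_norm_eq_inner
    by (simp add: inner_diff_left inner_diff_right inner_commute[of w u] power2_eq_square)
  then have nrm: "(norm (v - u))\<^sup>2 = 2 * p" by (simp add: s2)
  have "g\<^sup>2 > 0" using \<open>g > 0\<close> by simp
  then have "(norm (v - u))\<^sup>2 < g\<^sup>2" using p(3) unfolding nrm by linarith
  then have "dist v u < g" using \<open>g > 0\<close> by (simp add: dist_norm power_less_imp_less_base)
  then have close: "dist v u < r" "dist v u < d" by (auto simp: g_def)
  have "0 \<le> s * p * - (\<Sum>i\<in>UNIV. q i * w $ i * u $ i)"
    using \<open>s \<ge> 0\<close> p mixed by (intro mult_nonneg_nonneg) auto
  then have "diag_form q (v - u) \<ge> s\<^sup>2 * Q + p\<^sup>2 * diag_form q u"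
    unfolding h diag_form_combination Q_def[symmetric] by (simp add: mult_ac)
  also have "s\<^sup>2 * Q + p\<^sup>2 * diag_form q u = 2 * p * Q + p * (p * D)"
    unfolding s2 by (simp add: D_def algebra_simps power2_eq_square)
  finally have lower: "diag_form q (v - u) \<ge> 2 * p * Q + p * (p * D)" .
  have "p * (2 * (\<bar>D\<bar> + 1)) \<le> Q"
    using p(4) by (subst (asm) pos_le_divide_eq) auto
  moreover have "p * - D \<le> p * (\<bar>D\<bar> + 1)"
    using p by (intro mult_left_mono) auto
  ultimately have "p * D \<ge> - (Q / 2)" by (simp add: algebra_simps)
  then have "p * (p * D) \<ge> p * - (Q / 2)" using p by (intro mult_left_mono) auto
  moreover have "\<bar>f v - f u - diag_form q (v - u)\<bar> \<le> Q / 4 * (2 * p)"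
    using d[OF v close(2)] unfolding nrm .
  moreover have "p * Q > 0" using p \<open>Q > 0\<close> by simp
  moreover have "p * - (Q / 2) = - (p * Q / 2)" "Q / 4 * (2 * p) = p * Q / 2" "2 * p * Q = 2 * (p * Q)"
    by simp_all
  ultimately have "f v > f u" using lower by linarith
  then show False using r[OF v close(1)] by simp
qed

text \<open>
  Both \<open>w\<close> and \<open>- w\<close> are tangent with the same value of the form, and replacing one by the other
  flips the mixed term, which can thus be assumed nonpositive.
\<close>

lemma not_local_max_on_tangent:
  fixes u w :: "real ^ 'n::finite"
  assumes model: "second_order_model f feasible_set u q" and u: "u \<in> feasible_set"
    and w: "u \<bullet> w = 0" "w \<bullet> 1 = 0" and pos: "diag_form q w > 0"
  shows "\<not> local_max_on f feasible_set u"
proof -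
  have "w \<noteq> 0" using pos by (auto simp: diag_form_def)
  \<comment> \<open>The sign that makes the mixed term nonpositive.\<close>
  define \<sigma> :: real where "\<sigma> = (if (\<Sum>i\<in>UNIV. q i * w $ i * u $ i) \<le> 0 then 1 else - 1)"
  define c where "c = \<sigma> / norm w"
  have "c \<noteq> 0" using \<open>w \<noteq> 0\<close> by (auto simp: c_def \<sigma>_def)
  have "(c *\<^sub>R w) \<bullet> (c *\<^sub>R w) = 1"
    using \<open>w \<noteq> 0\<close> by (simp add: c_def \<sigma>_def dot_square_norm power2_eq_square)
  moreover have "(\<Sum>i\<in>UNIV. q i * (c *\<^sub>R w) $ i * u $ i) = c * (\<Sum>i\<in>UNIV. q i * w $ i * u $ i)"
    by (simp add: sum_distrib_left mult_ac)
  moreover have "c * (\<Sum>i\<in>UNIV. q i * w $ i * u $ i) \<le> 0"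
    using \<open>w \<noteq> 0\<close> by (auto simp: c_def \<sigma>_def divide_le_0_iff)
  moreover have "diag_form q (c *\<^sub>R w) > 0"
    using pos \<open>c \<noteq> 0\<close> by (simp add: diag_form_scaleR)
  ultimately show ?thesis
    using not_local_max_on_unit[OF model u, of "c *\<^sub>R w"] w by simp
qed

section \<open>The objective near a stationary point\<close>

text \<open>
  The remainders satisfy a recursion in the exponent: multiplying the expansion by \<open>x + s\<close> yields
  the next one, and the only new error is the quadratic term times \<open>s\<close>.
\<close>

lemma power_quadratic_remainder:
  fixes x :: real
  shows "\<exists>C\<ge>0. \<forall>s. \<bar>s\<bar> \<le> 1 \<longrightarrow>
    \<bar>(x + s) ^ (M + 2) - x ^ (M + 2) - real (M + 2) * x ^ (M + 1) * s
       - real (M + 2) * real (M + 1) / 2 * x ^ M * s\<^sup>2\<bar> \<le> C * \<bar>s\<bar> ^ 3"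
proof (induction M)
  case 0
  show ?case by (intro exI[of _ 0]) (simp add: power2_eq_square algebra_simps)
next
  case (Suc M)
  define R where "R = (\<lambda>M s. (x + s) ^ (M + 2) - x ^ (M + 2) - real (M + 2) * x ^ (M + 1) * s
       - real (M + 2) * real (M + 1) / 2 * x ^ M * s\<^sup>2)"
  obtain C where "C \<ge> 0" and C: "\<And>s. \<bar>s\<bar> \<le> 1 \<Longrightarrow> \<bar>R M s\<bar> \<le> C * \<bar>s\<bar> ^ 3"
    using Suc unfolding R_def by blast
  define B where "B = real (M + 2) * real (M + 1) / 2 * \<bar>x\<bar> ^ M"
  have rec: "R (Suc M) s = (x + s) * R M s + real (M + 2) * real (M + 1) / 2 * x ^ M * s ^ 3" for s
    by (simp add: R_def field_simps power2_eq_square power3_eq_cube)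
  have "\<bar>R (Suc M) s\<bar> \<le> ((\<bar>x\<bar> + 1) * C + B) * \<bar>s\<bar> ^ 3" if "\<bar>s\<bar> \<le> 1" for s
  proof -
    have "\<bar>R (Suc M) s\<bar> \<le> \<bar>x + s\<bar> * \<bar>R M s\<bar> + B * \<bar>s\<bar> ^ 3"
      unfolding rec B_def
      by (rule order_trans[OF abs_triangle_ineq]) (simp add: abs_mult power_abs)
    also have "\<bar>x + s\<bar> * \<bar>R M s\<bar> \<le> (\<bar>x\<bar> + 1) * (C * \<bar>s\<bar> ^ 3)"
      using C[OF that] that by (intro mult_mono) auto
    finally show ?thesis by (simp add: algebra_simps)
  qed
  moreover have "(\<bar>x\<bar> + 1) * C + B \<ge> 0" using \<open>C \<ge> 0\<close> by (simp add: B_def)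
  ultimately show ?case unfolding R_def by blast
qed

text \<open>
  Summing the coordinatewise expansions leaves the linear term \<open>m\<close> times the sum of
  \<open>u_i^(m - 1) h_i\<close>, which stationarity and the two constraints evaluate to \<open>- (m / 2) \<alpha> |h|^2\<close>.
  This is where \<open>\<alpha>\<close> enters the weights.
\<close>

lemma stationary_second_order_model:
  fixes u :: "real ^ 'n::finite"
  assumes u: "u \<in> feasible_set" and stat: "\<And>i. (u $ i) ^ (M + 1) = \<alpha> * u $ i + \<beta>"
  shows "second_order_model (objective (M + 2)) feasible_set u
           (\<lambda>i. real (M + 2) / 2 * (real (M + 1) * (u $ i) ^ M - \<alpha>))"
    (is "second_order_model _ _ _ ?q")
  unfolding second_order_model_def
proof (intro allI impI)
  fix e :: real assume "e > 0"
  define R where "R = (\<lambda>x s. (x + s) ^ (M + 2) - x ^ (M + 2) - real (M + 2) * x ^ (M + 1) * s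
       - real (M + 2) * real (M + 1) / 2 * x ^ M * s\<^sup>2 :: real)"
  obtain C where C0: "\<And>i. C i \<ge> 0"
    and C: "\<And>i s. \<bar>s\<bar> \<le> 1 \<Longrightarrow> \<bar>R (u $ i) s\<bar> \<le> C i * \<bar>s\<bar> ^ 3"
    using power_quadratic_remainder[of "u $ _" M] unfolding R_def by metis
  define K where "K = (\<Sum>i\<in>UNIV. C i)"
  have "K \<ge> 0" by (simp add: K_def C0 sum_nonneg)
  define d where "d = min 1 (e / (K + 1))"
  have "d > 0" using \<open>e > 0\<close> \<open>K \<ge> 0\<close> by (simp add: d_def)
  moreover have "\<bar>objective (M + 2) v - objective (M + 2) u - diag_form ?q (v - u)\<bar>
      \<le> e * (norm (v - u))\<^sup>2" if v: "v \<in> feasible_set" and "dist v u < d" for v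
  proof -
    define h where "h = v - u"
    have vi: "v $ i = u $ i + h $ i" for i by (simp add: h_def)
    have nh: "norm h \<le> 1" "norm h \<le> e / (K + 1)"
      using \<open>dist v u < d\<close> by (auto simp: h_def dist_norm d_def)
    have hi: "\<bar>h $ i\<bar> \<le> norm h" for i by (rule component_le_norm_cart)
    have "u \<bullet> h = - (h \<bullet> h) / 2"
    proof -
      have "v = u + h" by (simp add: h_def)
      then show ?thesis
        using u v by (simp add: feasible_set_def inner_add_left inner_add_right inner_commute[of h u])
    qed
    then have uh: "(\<Sum>i\<in>UNIV. u $ i * h $ i) = - (\<Sum>i\<in>UNIV. (h $ i)\<^sup>2) / 2"
      by (simp add: inner_vec_def power2_eq_square)
    have "h \<bullet> 1 = 0" using u v by (simp add: feasible_set_def h_def inner_diff_left)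
    then have h1: "(\<Sum>i\<in>UNIV. h $ i) = 0" by (simp add: inner_vec_def)
    have "(\<Sum>i\<in>UNIV. (u $ i) ^ (M + 1) * h $ i) = \<alpha> * (\<Sum>i\<in>UNIV. u $ i * h $ i) + \<beta> * (\<Sum>i\<in>UNIV. h $ i)"
      unfolding stat sum_distrib_left sum.distrib[symmetric]
      by (intro sum.cong refl) (simp add: algebra_simps)
    then have first: "(\<Sum>i\<in>UNIV. (u $ i) ^ (M + 1) * h $ i) = - \<alpha> / 2 * (\<Sum>i\<in>UNIV. (h $ i)\<^sup>2)"
      by (simp add: uh h1)
    have "objective (M + 2) v - objective (M + 2) u
        = (\<Sum>i\<in>UNIV. real (M + 2) * ((u $ i) ^ (M + 1) * h $ i)
             + real (M + 2) / 2 * (real (M + 1) * (u $ i) ^ M) * (h $ i)\<^sup>2 + R (u $ i) (h $ i))"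
      unfolding objective_def sum_subtractf[symmetric]
      by (intro sum.cong refl) (simp add: vi R_def)
    also have "\<dots> = real (M + 2) * (\<Sum>i\<in>UNIV. (u $ i) ^ (M + 1) * h $ i)
             + (\<Sum>i\<in>UNIV. real (M + 2) / 2 * (real (M + 1) * (u $ i) ^ M) * (h $ i)\<^sup>2)
             + (\<Sum>i\<in>UNIV. R (u $ i) (h $ i))"
      by (simp only: sum.distrib sum_distrib_left)
    also have "\<dots> = diag_form ?q h + (\<Sum>i\<in>UNIV. R (u $ i) (h $ i))"
      unfolding first diag_form_def sum_distrib_left
      by (simp only: sum.distrib[symmetric]) (intro sum.cong refl, simp add: field_simps)
    finally have eq: "objective (M + 2) v - objective (M + 2) u - diag_form ?q h
        = (\<Sum>i\<in>UNIV. R (u $ i) (h $ i))" by simp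
    have "\<bar>\<Sum>i\<in>UNIV. R (u $ i) (h $ i)\<bar> \<le> (\<Sum>i\<in>UNIV. C i * norm h ^ 3)"
    proof (rule order_trans[OF sum_abs sum_mono])
      fix i
      have "\<bar>R (u $ i) (h $ i)\<bar> \<le> C i * \<bar>h $ i\<bar> ^ 3"
        using C hi[of i] nh by (meson order_trans)
      also have "\<dots> \<le> C i * norm h ^ 3"
        using C0 hi by (intro mult_left_mono power_mono) auto
      finally show "\<bar>R (u $ i) (h $ i)\<bar> \<le> C i * norm h ^ 3" .
    qed
    also have "\<dots> = (K * norm h) * (norm h)\<^sup>2"
      by (simp add: K_def sum_distrib_right[symmetric] power2_eq_square power3_eq_cube)
    also have "\<dots> \<le> e * (norm h)\<^sup>2"
    proof (rule mult_right_mono)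
      have "norm h * (K + 1) \<le> e"
        using nh(2) \<open>K \<ge> 0\<close> by (subst (asm) pos_le_divide_eq) auto
      moreover have "norm h * (K + 1) = K * norm h + norm h" by (simp add: algebra_simps)
      ultimately show "K * norm h \<le> e" using norm_ge_zero[of h] by linarith
    qed simp
    finally show ?thesis unfolding eq[symmetric] unfolding h_def .
  qed
  ultimately show "\<exists>d>0. \<forall>v\<in>feasible_set. dist v u < d \<longrightarrow>
      \<bar>objective (M + 2) v - objective (M + 2) u - diag_form ?q (v - u)\<bar> \<le> e * (norm (v - u))\<^sup>2"
    by blast
qed

section \<open>Sign patterns of the weights\<close>

lemma card_ge_two_obtains:
  assumes "card A \<ge> 2" obtains i j where "i \<in> A" "j \<in> A" "i \<noteq> j"
  using assms by (metis One_nat_def Suc_1 Suc_le_lessD card.infinite card_le_Suc0_iff_eq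
      linorder_not_less not_less_zero)

text \<open>
  Where \<open>u\<close> has two equal coordinates, the difference of the two unit vectors is orthogonal to both
  \<open>u\<close> and the all-ones vector, hence tangent.
\<close>

lemma not_local_max_on_equal_coordinates:
  fixes u :: "real ^ 'n::finite"
  assumes model: "second_order_model f feasible_set u q" and u: "u \<in> feasible_set"
    and ij: "i \<noteq> j" "u $ i = u $ j" and q: "q i > 0" "q j > 0"
  shows "\<not> local_max_on f feasible_set u"
proof (rule not_local_max_on_tangent[OF model u])
  let ?w = "axis i 1 - axis j 1 :: real ^ 'n"
  show "u \<bullet> ?w = 0" "?w \<bullet> 1 = 0"
    using ij by (simp_all add: inner_diff_left inner_diff_right inner_axis inner_axis')
  have "diag_form q ?w = (\<Sum>t\<in>{i, j}. q t * (?w $ t)\<^sup>2)"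
    unfolding diag_form_def by (rule sum.mono_neutral_right) (auto simp: axis_def)
  also have "\<dots> = q i + q j" using ij by (simp add: axis_def)
  finally show "diag_form q ?w > 0" using q by simp
qed

lemma local_min_on_positive_weights:
  fixes u :: "real ^ 'n::finite"
  assumes model: "second_order_model f S u q" and "u \<in> S" and pos: "\<And>i. q i > 0"
  shows "local_min_on f S u"
proof -
  define c where "c = Min (range q)"
  have "c > 0" by (simp add: c_def pos)
  have c: "c \<le> q i" for i by (simp add: c_def)
  have "diag_form (\<lambda>i. - q i) h \<le> - c * (norm h)\<^sup>2" for h :: "real ^ 'n"
    unfolding diag_form_def norm_power2_vec sum_distrib_left
    by (intro sum_mono mult_right_mono) (simp_all add: c)
  then show ?thesis
    unfolding local_min_on_iff_local_max_on_uminus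
    using local_max_on_sufficient[OF second_order_model_uminus[OF model] \<open>u \<in> S\<close> \<open>c > 0\<close> zero_less_one]
    by blast
qed

text \<open>
  When only coordinate \<open>j\<close> differs from the common value \<open>b\<close>, the constraints combine to
  \<open>(a - b) h_j = - |h|^2 / 2\<close>. So \<open>h_j^2\<close> is of fourth order, and the positive weight at \<open>j\<close>
  is harmless.
\<close>

lemma local_max_on_single_positive_weight:
  fixes u :: "real ^ 'n::finite"
  assumes model: "second_order_model f feasible_set u (\<lambda>i. if i \<in> {j} then p else - q)"
    and u: "u \<in> feasible_set" and "p > 0" "q > 0"
    and vals: "\<And>i. u $ i = (if i \<in> {j} then a else b)" and "a \<noteq> b"
  shows "local_max_on f feasible_set u"
proof (rule local_max_on_sufficient[OF model u])
  \<comment> \<open>Raising the weight at \<open>j\<close> from \<open>- q\<close> to \<open>p\<close> contributes \<open>C |h|^4\<close>; within the radius below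
      this uses up at most half of \<open>q |h|^2\<close>.\<close>
  define C where "C = (p + q) / (4 * (a - b)\<^sup>2)"
  have "C > 0" using assms by (simp add: C_def)
  show "q / 2 > 0" using \<open>q > 0\<close> by simp
  show "sqrt (q / (2 * C)) > 0" using \<open>q > 0\<close> \<open>C > 0\<close> by simp
  fix v assume v: "v \<in> feasible_set" and close: "dist v u < sqrt (q / (2 * C))"
  define h where "h = v - u"
  have "v = u + h" by (simp add: h_def)
  then have uh: "u \<bullet> h = - (norm h)\<^sup>2 / 2" and "h \<bullet> 1 = 0"
    using u v by (simp_all add: feasible_set_def inner_add_left inner_add_right inner_commute[of h u]
        power2_norm_eq_inner)
  have "u \<bullet> h = (\<Sum>i\<in>UNIV. b * h $ i + (if i = j then (a - b) * h $ i else 0))"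
    unfolding inner_vec_def by (intro sum.cong refl) (simp add: vals algebra_simps)
  also have "\<dots> = b * (h \<bullet> 1) + (a - b) * h $ j"
    by (simp add: sum.distrib inner_vec_def sum_distrib_left)
  finally have hj: "(a - b) * h $ j = - (norm h)\<^sup>2 / 2" using uh \<open>h \<bullet> 1 = 0\<close> by simp
  have "(a - b)\<^sup>2 * (h $ j)\<^sup>2 = ((norm h)\<^sup>2 / 2)\<^sup>2"
    unfolding power_mult_distrib[symmetric] hj by simp
  moreover have "p + q = 4 * C * (a - b)\<^sup>2" using \<open>a \<noteq> b\<close> by (simp add: C_def)
  ultimately have "(p + q) * (h $ j)\<^sup>2 = 4 * C * ((norm h)\<^sup>2 / 2)\<^sup>2"
    by (simp only: mult.assoc)
  also have "\<dots> = C * (norm h)\<^sup>2 * (norm h)\<^sup>2" by (simp add: power2_eq_square)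
  also have "\<dots> \<le> q / 2 * (norm h)\<^sup>2"
  proof (rule mult_right_mono)
    have "(norm h)\<^sup>2 \<le> (sqrt (q / (2 * C)))\<^sup>2"
      using close by (intro power_mono) (simp_all add: h_def dist_norm)
    then show "C * (norm h)\<^sup>2 \<le> q / 2" using \<open>q > 0\<close> \<open>C > 0\<close> by (simp add: field_simps)
  qed simp
  finally have small: "(p + q) * (h $ j)\<^sup>2 \<le> q / 2 * (norm h)\<^sup>2" .
  have "diag_form (\<lambda>i. if i \<in> {j} then p else - q) h
      = (\<Sum>i\<in>UNIV. - q * (h $ i)\<^sup>2 + (if i = j then (p + q) * (h $ i)\<^sup>2 else 0))"
    unfolding diag_form_def by (intro sum.cong refl) (simp add: algebra_simps)
  also have "\<dots> = - q * (norm h)\<^sup>2 + (p + q) * (h $ j)\<^sup>2"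
    by (subst sum.distrib) (simp add: norm_power2_vec sum_distrib_left sum_negf)
  finally show "diag_form (\<lambda>i. if i \<in> {j} then p else - q) (v - u) \<le> - (q / 2) * (norm (v - u))\<^sup>2"
    using small unfolding h_def by simp
qed

section \<open>The weights at a two-valued point\<close>

text \<open>
  The equation \<open>x^(M + 1) = \<alpha> x + \<beta>\<close> at \<open>x = r c\<close> and \<open>x = - c\<close> is a linear system for the
  multipliers; by evenness of \<open>M\<close> its solution is the one used here, and \<open>(- c)^M\<close> becomes \<open>c^M\<close>
  in the weights.
\<close>

lemma two_value_second_order:
  fixes u :: "real ^ 'n::finite" and r c :: real
  assumes u: "u \<in> feasible_set" and vals: "\<And>i. u $ i = (if i \<in> A then r * c else - c)"
    and "r \<ge> 1" and "even M"
  obtains \<alpha> where "\<alpha> = c ^ M * (r ^ (M + 1) + 1) / (r + 1)"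
    and "stationary_point (M + 2) u"
    and "second_order_model (objective (M + 2)) feasible_set u
          (\<lambda>i. if i \<in> A then real (M + 2) / 2 * (real (M + 1) * (r * c) ^ M - \<alpha>)
               else real (M + 2) / 2 * (real (M + 1) * c ^ M - \<alpha>))"
proof -
  define \<alpha> where "\<alpha> = c ^ M * (r ^ (M + 1) + 1) / (r + 1)"
  define \<beta> where "\<beta> = c ^ (M + 1) * (r ^ (M + 1) - r) / (r + 1)"
  have stat: "(u $ i) ^ (M + 1) = \<alpha> * u $ i + \<beta>" for i
  proof -
    define K where "K = r ^ (M + 1)"
    have rhs: "\<alpha> * (x * c) + \<beta> = c ^ (M + 1) * (((K + 1) * x + K - r) / (r + 1))" for x
      by (simp add: \<alpha>_def \<beta>_def K_def add_divide_distrib diff_divide_distrib algebra_simps)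
    have "(K + 1) * r + K - r = K * (r + 1)" "(K + 1) * - 1 + K - r = - 1 * (r + 1)"
      by (simp_all add: algebra_simps)
    then have "((K + 1) * r + K - r) / (r + 1) = K" "((K + 1) * - 1 + K - r) / (r + 1) = - 1"
      using \<open>r \<ge> 1\<close> by (simp_all only: nonzero_mult_div_cancel_right)
    moreover have powers: "(r * c) ^ (M + 1) = c ^ (M + 1) * K" "(- c) ^ (M + 1) = c ^ (M + 1) * - 1"
      using \<open>even M\<close> by (simp_all add: K_def power_mult_distrib)
    ultimately have "\<alpha> * (r * c) + \<beta> = (r * c) ^ (M + 1)" "\<alpha> * - c + \<beta> = (- c) ^ (M + 1)"
      using rhs[of r] rhs[of "- 1"] powers by (simp_all only: mult_minus1)
    then show ?thesis by (simp add: vals)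
  qed
  have "stationary_point (M + 2) u"
    unfolding stationary_point_def
  proof (intro conjI exI allI)
    show "(u $ i) ^ (M + 2 - 1) - \<alpha> * u $ i - \<beta> = 0" for i using stat[of i] by simp
  qed (rule u)
  moreover have "(\<lambda>i. real (M + 2) / 2 * (real (M + 1) * (u $ i) ^ M - \<alpha>)) =
     (\<lambda>i. if i \<in> A then real (M + 2) / 2 * (real (M + 1) * (r * c) ^ M - \<alpha>)
          else real (M + 2) / 2 * (real (M + 1) * c ^ M - \<alpha>))"
    using \<open>even M\<close> by (auto simp: vals)
  ultimately show thesis
    using that[OF \<alpha>_def] stationary_second_order_model[OF u stat] by simp
qed

text \<open>
  Since \<open>r \<ge> 1\<close>, already \<open>r^M (r + 1)\<close> dominates \<open>r^(M + 1) + 1\<close>, so the factor \<open>M + 1\<close> makes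
  the inequality strict.
\<close>

lemma two_value_weight_pos:
  fixes r c :: real
  assumes "r \<ge> 1" "c > 0" "M > 0"
  shows "real (M + 1) * (r * c) ^ M - c ^ M * (r ^ (M + 1) + 1) / (r + 1) > 0"
proof -
  have "r ^ (M + 1) + 1 \<le> r ^ M * (r + 1)"
    using one_le_power[OF \<open>r \<ge> 1\<close>, of M] by (simp add: algebra_simps)
  also have "\<dots> < real (M + 1) * (r ^ M * (r + 1))"
    using assms by simp
  finally have "0 < c ^ M * (real (M + 1) * (r ^ M * (r + 1)) - (r ^ (M + 1) + 1)) / (r + 1)"
    using assms by simp
  also have "\<dots> = real (M + 1) * (r * c) ^ M - c ^ M * (r ^ (M + 1) + 1) / (r + 1)"
    using assms by (simp add: power_mult_distrib field_simps)
  finally show ?thesis .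
qed

text \<open>
  The homogeneous form of \<open>l\<close>: substituting \<open>n - k = r k\<close> and \<open>n = (r + 1) k\<close> makes every summand a
  multiple of \<open>k^(M + 1)\<close>.
\<close>

lemma l_eq:
  assumes "r * real k = real n - real k"
  shows "l (M + 2) n k = real k ^ (M + 1) * (real (M + 1) * (r + 1) - (r ^ (M + 1) + 1))"
proof -
  have n: "real n = real k * (r + 1)" using assms by (simp add: algebra_simps)
  have "(real n - real k) ^ (M + 1) = r ^ (M + 1) * real k ^ (M + 1)"
    unfolding assms[symmetric] by (rule power_mult_distrib)
  then show ?thesis
    unfolding l_def by (simp add: n algebra_simps)
qed

lemma two_value_weight_eq_l:
  fixes r c :: real
  assumes "r \<ge> 1" "k > 0" "r * real k = real n - real k"
  shows "real (M + 1) * c ^ M - c ^ M * (r ^ (M + 1) + 1) / (r + 1)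
       = c ^ M / ((r + 1) * real k ^ (M + 1)) * l (M + 2) n k"
proof -
  define D where "D = real (M + 1) * (r + 1) - (r ^ (M + 1) + 1)"
  have "real (M + 1) * c ^ M - c ^ M * (r ^ (M + 1) + 1) / (r + 1) = c ^ M * (D / (r + 1))"
    using \<open>r \<ge> 1\<close> by (simp add: D_def diff_divide_distrib right_diff_distrib)
  also have "\<dots> = c ^ M / ((r + 1) * real k ^ (M + 1)) * l (M + 2) n k"
    using \<open>k > 0\<close> unfolding l_eq[OF assms(3)] D_def[symmetric] by simp
  finally show ?thesis .
qed

text \<open>
  For \<open>r = n - 1\<close> and \<open>M = m - 2\<close> this says \<open>l m n 1 < 0\<close>. Equality holds at the excluded pair, so the
  induction on \<open>M\<close> starts one step later when \<open>r = 2\<close>.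
\<close>

lemma linear_less_power:
  fixes r :: nat
  assumes "r \<ge> 2" "M \<ge> 2" "(r, M) \<noteq> (2, 2)"
  shows "(M + 1) * (r + 1) < r ^ (M + 1) + 1"
proof -
  have grow: "(Suc M + 1) * (r + 1) < r ^ (Suc M + 1) + 1"
    if "(M + 1) * (r + 1) < r ^ (M + 1) + 1" "M \<ge> 2" for M
  proof -
    define N where "N = r ^ (M + 1)"
    have "r \<le> r ^ M"
      using that(2) \<open>r \<ge> 2\<close> by (intro self_le_power) auto
    then have "r * 2 \<le> N"
      using \<open>r \<ge> 2\<close> mult_le_mono[of r "r ^ M" 2 r] by (simp add: N_def mult.commute)
    moreover have "2 * N \<le> r ^ (Suc M + 1)" using \<open>r \<ge> 2\<close> by (simp add: N_def)
    moreover have "(Suc M + 1) * (r + 1) = (M + 1) * (r + 1) + (r + 1)" by simp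
    ultimately show ?thesis using that(1) \<open>r \<ge> 2\<close> unfolding N_def[symmetric] by linarith
  qed
  show ?thesis
  proof (cases "r = 2")
    case True
    then have "M \<ge> 3" using assms by auto
    then show ?thesis
    proof (induction rule: dec_induct)
      case base then show ?case by (simp add: True)
    next
      case (step M) then show ?case using grow[of M] by simp
    qed
  next
    case False
    then have "r \<ge> 3" using assms by simp
    from \<open>M \<ge> 2\<close> show ?thesis
    proof (induction rule: dec_induct)
      case base
      have "3 * 3 \<le> r * r" using \<open>r \<ge> 3\<close> by (intro mult_le_mono)
      then have "r * 9 \<le> r * (r * r)" by simp
      then show ?case using \<open>r \<ge> 3\<close> by (simp add: power3_eq_cube eval_nat_numeral)
    next
      case (step M) then show ?case using grow[of M] by simp
    qed
  qed
qed

section \<open>Two-valued feasible points\<close>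

lemma two_value_feasible:
  fixes u :: "real ^ 'n::finite"
  assumes vals: "\<And>i. u $ i = (if i \<in> A then a else b)"
    and "real (card A) * a + real (card (- A)) * b = 0"
    and "real (card A) * a\<^sup>2 + real (card (- A)) * b\<^sup>2 = 1"
  shows "u \<in> feasible_set"
proof -
  have split: "(\<Sum>i\<in>UNIV. if i \<in> A then x else y) = real (card A) * x + real (card (- A)) * y"
    for x y :: real
    by (simp add: sum.If_cases Compl_eq)
  have "u \<bullet> u = (\<Sum>i\<in>UNIV. if i \<in> A then a\<^sup>2 else b\<^sup>2)"
    unfolding inner_vec_def by (intro sum.cong refl) (simp add: vals power2_eq_square)
  moreover have "u \<bullet> 1 = (\<Sum>i\<in>UNIV. if i \<in> A then a else b)"
    unfolding inner_vec_def by (intro sum.cong refl) (simp add: vals)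
  ultimately show ?thesis
    using assms(2,3) unfolding feasible_set_def split by simp
qed

text \<open>
  Only the set of coordinates carrying the value \<open>a\<close> and its size matter below; this removes the
  numbering of the coordinates and the permutation matrix.
\<close>

lemma permuted_two_block_vec:
  fixes pos :: "'n::finite \<Rightarrow> nat"
  assumes "permutation_matrix P" "bij_betw pos UNIV {1..n}" "k \<le> n"
  obtains A where "card A = k" and "\<And>i. (P *v two_block_vec pos k a b) $ i = (if i \<in> A then a else b)"
proof -
  obtain p where p: "p permutes UNIV" and P: "P = (\<chi> i j. if i = p j then 1 else 0)"
    using assms(1) unfolding permutation_matrix_def by blast
  have entry: "(P *v w) $ i = w $ (inv p i)" for w i
  proof -
    have "(P *v w) $ i = (\<Sum>j\<in>UNIV. if j = inv p i then w $ j else 0)"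
      unfolding P matrix_vector_mult_def vec_lambda_beta
      by (intro sum.cong refl) (auto simp: permutes_inverses[OF p])
    then show ?thesis by simp
  qed
  define A where "A = p ` {j. pos j \<le> k}"
  have "pos ` {j. pos j \<le> k} = {1..k}"
  proof (intro equalityI subsetI)
    fix x assume x: "x \<in> {1..k}"
    then have "x \<in> range pos" using assms(2,3) by (simp add: bij_betw_def)
    then show "x \<in> pos ` {j. pos j \<le> k}" using x by auto
  qed (use assms(2) in \<open>auto simp: bij_betw_def\<close>)
  moreover have "inj pos" "inj p"
    using assms(2) permutes_inj[OF p] by (auto simp: bij_betw_def)
  ultimately have "card A = k"
    unfolding A_def by (metis card_atLeastAtMost card_image diff_Suc_1 inj_on_subset subset_UNIV)
  moreover have "i \<in> A \<longleftrightarrow> pos (inv p i) \<le> k" for i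
    unfolding A_def using permutes_inverses[OF p] by (auto simp: image_iff)
  ultimately show thesis using that by (simp add: entry two_block_vec_def)
qed

theorem lemma4:
  fixes n m k :: nat
    and a b :: real
    and pos :: "'n::finite \<Rightarrow> nat"
    and P :: "real ^ 'n ^ 'n"
    and u :: "real ^ 'n"
  assumes "n \<ge> 3" and "CARD('n) = n"
    and "m \<ge> 4" and "even m" and "(n, m) \<noteq> (3, 4)"
    and "1 \<le> k" and "k \<le> n div 2"
    and "a = sqrt ((real n - real k) / (real k * real n))"
    and "b = - sqrt (real k / ((real n - real k) * real n))"
    and "bij_betw pos UNIV {1..n}"
    and "permutation_matrix P"
    and "u = P *v two_block_vec pos k a b"
  shows "stationary_point m u
    \<and> (k = 1 \<longrightarrow> local_max_on (objective m) feasible_set u)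
    \<and> (2 \<le> k \<longrightarrow>
         (l m n k > 0 \<longrightarrow> local_min_on (objective m) feasible_set u)
       \<and> (l m n k < 0 \<longrightarrow> saddle_point m u))"
proof -
  obtain A where A: "card A = k" and u_AB: "\<And>i. u $ i = (if i \<in> A then a else b)"
    using permuted_two_block_vec[OF assms(11,10), of k] assms(7,12) by (metis div_le_dividend order_trans)
  have k: "0 < real k" "2 * real k \<le> real n" using assms(6,7) by auto
  have cardB: "card (- A) = n - k"
    using A assms(2) by (simp add: Compl_eq_Diff_UNIV card_Diff_subset)
  define M where "M = m - 2"
  have m: "m = M + 2" and "M \<ge> 2" and "even M" using assms(3,4) by (auto simp: M_def)
  define r where "r = (real n - real k) / real k"
  define c where "c = sqrt (real k / ((real n - real k) * real n))"
  have rk: "r * real k = real n - real k" using k by (simp add: r_def)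
  have "r \<ge> 1" using k by (simp add: r_def)
  have "c > 0" using k by (simp add: c_def)
  have c2: "c\<^sup>2 = real k / ((real n - real k) * real n)" using k by (simp add: c_def)
  have "b = - c" using assms(9) by (simp add: c_def)
  have "a = r * c"
  proof -
    have "(real n - real k) / (real k * real n) = r\<^sup>2 * (real k / ((real n - real k) * real n))"
      using k by (simp add: r_def field_simps power2_eq_square)
    then show ?thesis
      using assms(8) \<open>r \<ge> 1\<close> by (simp only: c_def real_sqrt_mult real_sqrt_pow2) simp
  qed
  have vals: "u $ i = (if i \<in> A then r * c else - c)" for i
    using u_AB by (simp add: \<open>a = r * c\<close> \<open>b = - c\<close>)
  have u: "u \<in> feasible_set"
  proof (rule two_value_feasible[OF vals])
    have "real (card A) = real k" "real (card (- A)) = r * real k"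
      using A cardB rk k by (simp_all add: of_nat_diff)
    moreover have "real k * (r * c)\<^sup>2 + r * real k * c\<^sup>2 = 1"
    proof -
      have "real k * (r * c)\<^sup>2 + r * real k * c\<^sup>2 = (r * real k) * (r * real k + real k) / real k * c\<^sup>2"
        using k by (simp add: field_simps power2_eq_square)
      also have "\<dots> = 1" unfolding rk c2 using k by (simp add: field_simps)
      finally show ?thesis .
    qed
    ultimately show "real (card A) * (r * c) + real (card (- A)) * - c = 0"
      "real (card A) * (r * c)\<^sup>2 + real (card (- A)) * (- c)\<^sup>2 = 1"
      by simp_all
  qed
  obtain \<alpha> where \<alpha>: "\<alpha> = c ^ M * (r ^ (M + 1) + 1) / (r + 1)"
    and stat: "stationary_point (M + 2) u"
    and model: "second_order_model (objective (M + 2)) feasible_set u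
          (\<lambda>i. if i \<in> A then real (M + 2) / 2 * (real (M + 1) * (r * c) ^ M - \<alpha>)
               else real (M + 2) / 2 * (real (M + 1) * c ^ M - \<alpha>))"
    using two_value_second_order[OF u vals \<open>r \<ge> 1\<close> \<open>even M\<close>] by blast
  define qA where "qA = real (M + 2) / 2 * (real (M + 1) * (r * c) ^ M - \<alpha>)"
  define qB where "qB = real (M + 2) / 2 * (real (M + 1) * c ^ M - \<alpha>)"
  note model = model[folded qA_def qB_def]
  have "qA > 0"
    unfolding qA_def \<alpha> using two_value_weight_pos[OF \<open>r \<ge> 1\<close> \<open>c > 0\<close>, of M] \<open>M \<ge> 2\<close> by simp
  define t where "t = real (M + 2) / 2 * (c ^ M / ((r + 1) * real k ^ (M + 1)))"
  have "t > 0" using k \<open>r \<ge> 1\<close> \<open>c > 0\<close> by (simp add: t_def)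
  have qB: "qB = t * l m n k"
    unfolding qB_def \<alpha> m t_def
    using two_value_weight_eq_l[OF \<open>r \<ge> 1\<close> _ rk, of M c] assms(6) by simp
  have max: "local_max_on (objective m) feasible_set u" if "k = 1"
  proof -
    have r: "r = real (n - 1)" using that assms(1) by (simp add: r_def of_nat_diff)
    have "(M + 1) * ((n - 1) + 1) < (n - 1) ^ (M + 1) + 1"
      using assms(1,5) \<open>M \<ge> 2\<close> m by (intro linear_less_power) auto
    then have "real ((M + 1) * ((n - 1) + 1)) < real ((n - 1) ^ (M + 1) + 1)"
      by (rule of_nat_less_iff[THEN iffD2])
    then have "real (M + 1) * (r + 1) < r ^ (M + 1) + 1"
      unfolding r by (simp only: of_nat_add of_nat_mult of_nat_power of_nat_1)
    then have "l m n k < 0" unfolding m l_eq[OF rk] using that by simp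
    then have "- qB > 0" unfolding qB using \<open>t > 0\<close> by (simp add: mult_less_0_iff)
    have "card A = 1" using A that by simp
    then obtain j where "A = {j}" by (rule card_1_singletonE)
    have "r * c > 0" using \<open>r \<ge> 1\<close> \<open>c > 0\<close> by simp
    then have "r * c \<noteq> - c" using \<open>c > 0\<close> by linarith
    then show ?thesis
      using local_max_on_single_positive_weight[of "objective m" u j qA "- qB" "r * c" "- c",
            unfolded minus_minus]
        model vals u \<open>qA > 0\<close> \<open>- qB > 0\<close> unfolding m \<open>A = {j}\<close> by simp
  qed
  have min: "local_min_on (objective m) feasible_set u" if "l m n k > 0"
  proof -
    have "qB > 0" unfolding qB using \<open>t > 0\<close> that by simp
    then show ?thesis
      using local_min_on_positive_weights[OF model u] \<open>qA > 0\<close> m by simp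
  qed
  have saddle: "saddle_point m u" if "2 \<le> k" and neg: "l m n k < 0"
  proof -
    have "qB < 0" unfolding qB using \<open>t > 0\<close> neg by (simp add: mult_less_0_iff)
    have "card A \<ge> 2" using A \<open>2 \<le> k\<close> by simp
    then obtain i j where "i \<in> A" "j \<in> A" "i \<noteq> j"
      by (rule card_ge_two_obtains)
    then have "\<not> local_max_on (objective m) feasible_set u"
      using not_local_max_on_equal_coordinates[OF model u \<open>i \<noteq> j\<close>] \<open>qA > 0\<close> m by (simp add: vals)
    moreover have "card (- A) \<ge> 2" using cardB \<open>2 \<le> k\<close> assms(7) by linarith
    then obtain i' j' where "i' \<in> - A" "j' \<in> - A" "i' \<noteq> j'"
      by (rule card_ge_two_obtains)
    then have "\<not> local_max_on (\<lambda>v. - objective m v) feasible_set u"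
      using not_local_max_on_equal_coordinates[OF second_order_model_uminus[OF model] u \<open>i' \<noteq> j'\<close>]
        \<open>qB < 0\<close> m by (simp add: vals)
    ultimately show ?thesis
      using stat m by (simp add: saddle_point_def local_min_on_iff_local_max_on_uminus)
  qed
  show ?thesis using stat m max min saddle by simp
qed

end
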